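(* Let $U$ be a real normed linear space with continuous dual $U^*$, let $\Lambda=\{\lambda_1,\ldots,\lambda_M\}\subset U^*$ be a finite set of functionals such that the data map $U\to\mathbb{R}^M$, $f\mapsto\Lambda(f)=(\lambda_1(f),\ldots,\lambda_M(f))^T$, is surjective, and let $\mu\in U^*$ be a functional that has a bump function with respect to $\Lambda$. Then for every recovery vector $a_\Lambda=(a_{\lambda_1},\ldots,a_{\lambda_M})^T\in U^M$ and every bump function $f_{\mu,\Lambda}\in U$ for $\mu$ with respect to $\Lambda$, $$1\leq P_{a_\Lambda}(\mu)\,\|f_{\mu,\Lambda}\|_U .$$ Moreover, $$\frac{1}{\inf_{a_\Lambda\in U^M}P_{a_\Lambda}(\mu)}\leq \inf\{\|f\|_U : f\in U,\ \mu(f)=1,\ \Lambda(f)=0\}.$$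
   Context: The norms on $U$ and $U^*$ are dual to each other: $\|f\|_U=\sup_{0\neq\mu\in U^*}\mu(f)/\|\mu\|_{U^*}$ and $\|\mu\|_{U^*}=\sup_{0\neq f\in U}\mu(f)/\|f\|_U$. A vector $a_\Lambda=(a_{\lambda_1},\ldots,a_{\lambda_M})^T\in U^M$ defines the linear recovery map $R_{a_\Lambda}:U\to U$, $R_{a_\Lambda}(f)=a_\Lambda^T\Lambda(f)=\sum_{j=1}^M \lambda_j(f)\,a_{\lambda_j}$. The Generalized Power Function of the recovery at $\mu\in U^*$ is the dual norm of the error functional $f\mapsto \mu(f)-\mu(R_{a_\Lambda}(f))$: $$P_{a_\Lambda}(\mu)=\Big\|\mu-\sum_{j=1}^M\mu(a_{\lambda_j})\lambda_j\Big\|_{U^*}.$$ A bump function for $\mu$ with respect to $\Lambda$ is a function $f_{\mu,\Lambda}\in U$ with $\mu(f_{\mu,\Lambda})=1$ and $\lambda_j(f_{\mu,\Lambda})=0$ for all $j=1,\ldots,M$. *)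

theory Defs
  imports "HOL-Analysis.Analysis"
begin

text \<open>
  The continuous dual of \<open>'u\<close> is the type \<open>'u \<Rightarrow>\<^sub>L real\<close> of bounded linear functionals, whose
  library norm is the operator norm, i.e. the dual norm. The functionals, the data and the
  recovery vectors are indexed by a finite type \<open>'m\<close>, with \<open>M = CARD('m)\<close>.
\<close>

definition data_map ::
  "('u::real_normed_vector \<Rightarrow>\<^sub>L real) ^ 'm \<Rightarrow> 'u \<Rightarrow> real ^ 'm" where
  "data_map \<Lambda> f = (\<chi> j. blinfun_apply (\<Lambda> $ j) f)"

definition recovery_map ::
  "('u::real_normed_vector \<Rightarrow>\<^sub>L real) ^ 'm::finite \<Rightarrow> 'u ^ 'm \<Rightarrow> 'u \<Rightarrow> 'u" where
  "recovery_map \<Lambda> a f = (\<Sum>j\<in>UNIV. data_map \<Lambda> f $ j *\<^sub>R a $ j)"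

definition power_function ::
  "('u::real_normed_vector \<Rightarrow>\<^sub>L real) ^ 'm::finite \<Rightarrow> 'u ^ 'm \<Rightarrow> ('u \<Rightarrow>\<^sub>L real) \<Rightarrow> real" where
  "power_function \<Lambda> a \<mu> = norm (\<mu> - (\<Sum>j\<in>UNIV. blinfun_apply \<mu> (a $ j) *\<^sub>R \<Lambda> $ j))"

definition bump_function ::
  "('u::real_normed_vector \<Rightarrow>\<^sub>L real) ^ 'm \<Rightarrow> ('u \<Rightarrow>\<^sub>L real) \<Rightarrow> 'u \<Rightarrow> bool" where
  "bump_function \<Lambda> \<mu> f \<longleftrightarrow>
     blinfun_apply \<mu> f = 1 \<and> (\<forall>j. blinfun_apply (\<Lambda> $ j) f = 0)"

text \<open>The power function is the dual norm of the error functional of the recovery.\<close>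

lemma power_function_eq_onorm:
  "power_function \<Lambda> a \<mu> =
     onorm (\<lambda>f. blinfun_apply \<mu> f - blinfun_apply \<mu> (recovery_map \<Lambda> a f))"
proof -
  have "blinfun_apply (\<mu> - (\<Sum>j\<in>UNIV. blinfun_apply \<mu> (a $ j) *\<^sub>R \<Lambda> $ j)) =
    (\<lambda>f. blinfun_apply \<mu> f - blinfun_apply \<mu> (recovery_map \<Lambda> a f))"
    by (rule ext) (simp add: recovery_map_def data_map_def blinfun.diff_left blinfun.sum_left
      blinfun.scaleR_left blinfun.sum_right blinfun.scaleR_right mult.commute)
  then show ?thesis
    by (simp add: power_function_def norm_blinfun.rep_eq)
qed

end

theory Submission
  imports Defs
begin

text \<open>
  Both inequalities rest on one evaluation: a bump function \<open>f\<close> is annihilated by every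
  \<open>\<Lambda> $ j\<close>, so the error functional takes the value \<open>\<mu>(f) = 1\<close> at \<open>f\<close> for every recovery vector,
  and its dual norm is at least \<open>1 / norm f\<close>. As this bound does not depend on the recovery
  vector, it passes to the infimum of the power function, which is therefore positive; taking
  reciprocals and then the infimum over all bump functions gives the second inequality.
\<close>

lemma bump_function_iff_data_map:
  "bump_function \<Lambda> \<mu> f \<longleftrightarrow> blinfun_apply \<mu> f = 1 \<and> data_map \<Lambda> f = 0"
  by (simp add: bump_function_def data_map_def vec_eq_iff)

lemma one_le_power_function_mult_norm_bump:
  assumes "bump_function \<Lambda> \<mu> f"
  shows "1 \<le> power_function \<Lambda> a \<mu> * norm f"
proof -
  have "blinfun_apply (\<mu> - (\<Sum>j\<in>UNIV. blinfun_apply \<mu> (a $ j) *\<^sub>R \<Lambda> $ j)) f = 1"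
    using assms
    by (simp add: bump_function_def blinfun.diff_left blinfun.sum_left blinfun.scaleR_left)
  then show ?thesis
    using norm_blinfun[of "\<mu> - (\<Sum>j\<in>UNIV. blinfun_apply \<mu> (a $ j) *\<^sub>R \<Lambda> $ j)" f]
    by (simp add: power_function_def)
qed

lemma inverse_INF_power_function_le_norm_bump:
  assumes "bump_function \<Lambda> \<mu> f"
  shows "1 / (INF a. power_function \<Lambda> a \<mu>) \<le> norm f"
proof -
  have "f \<noteq> 0"
    using assms by (auto simp: bump_function_def)
  then have pos: "norm f > 0"
    by simp
  have "1 / norm f \<le> (INF a. power_function \<Lambda> a \<mu>)"
  proof (rule cINF_greatest)
    show "1 / norm f \<le> power_function \<Lambda> a \<mu>" for a
      using one_le_power_function_mult_norm_bump[OF assms, of a] pos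
      by (simp add: pos_divide_le_eq)
  qed simp
  then have "1 / (INF a. power_function \<Lambda> a \<mu>) \<le> 1 / (1 / norm f)"
    using frac_le[OF zero_le_one order_refl, of "1 / norm f"] pos by simp
  then show ?thesis
    by simp
qed

theorem theorem1:
  fixes \<Lambda> :: "('u::real_normed_vector \<Rightarrow>\<^sub>L real) ^ 'm::finite"
    and \<mu> :: "'u \<Rightarrow>\<^sub>L real"
  assumes "surj (data_map \<Lambda>)"
    and "\<exists>f. bump_function \<Lambda> \<mu> f"
  shows "(\<forall>a f. bump_function \<Lambda> \<mu> f \<longrightarrow> 1 \<le> power_function \<Lambda> a \<mu> * norm f) \<and>
    1 / (INF a. power_function \<Lambda> a \<mu>) \<le>
      Inf {norm f |f. blinfun_apply \<mu> f = 1 \<and> data_map \<Lambda> f = 0}"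
proof (intro conjI allI impI)
  show "1 \<le> power_function \<Lambda> a \<mu> * norm f" if "bump_function \<Lambda> \<mu> f" for a f
    using that by (rule one_le_power_function_mult_norm_bump)
  show "1 / (INF a. power_function \<Lambda> a \<mu>) \<le>
      Inf {norm f |f. blinfun_apply \<mu> f = 1 \<and> data_map \<Lambda> f = 0}"
  proof (rule cInf_greatest)
    show "{norm f |f. blinfun_apply \<mu> f = 1 \<and> data_map \<Lambda> f = 0} \<noteq> {}"
      using assms(2) by (auto simp: bump_function_iff_data_map)
  next
    fix x
    assume "x \<in> {norm f |f. blinfun_apply \<mu> f = 1 \<and> data_map \<Lambda> f = 0}"
    then obtain f where "x = norm f" and "bump_function \<Lambda> \<mu> f"
      by (auto simp: bump_function_iff_data_map)
    then show "1 / (INF a. power_function \<Lambda> a \<mu>) \<le> x"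
      using inverse_INF_power_function_le_norm_bump by simp
  qed
qed

end
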